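(* Let $n \in \mathbb{N}$, $n \geq 1$. For every collection $A_1, \ldots, A_n$ of non-empty finite subsets of $\mathbb{R}^n$, there is a hyperplane $H$ in $\mathbb{R}^n$ such that for each $1 \leq i \leq n$, $H$ bisects $A_i$ and $H \cap A_i \neq \emptyset$.
   Context: A hyperplane in $\mathbb{R}^n$ means an $(n-1)$-dimensional affine hyperplane $H = \{x \in \mathbb{R}^n : \langle u, x\rangle = c\}$, where $u \in \mathbb{R}^n$ with $|u| = 1$, $c \geq 0$, and $\langle\cdot,\cdot\rangle$ is the standard inner product. Its two open half-spaces are $H^+ = \{x \in \mathbb{R}^n: \langle u,x\rangle > c\}$ and $H^- = \{x \in \mathbb{R}^n : \langle u,x\rangle < c\}$. Writing $\#\{A\}$ for the cardinality of $A$, the hyperplane $H$ bisects a finite set $A \subset \mathbb{R}^n$ if both $\#\{A \cap H^+\} \leq \#\{A\}/2$ and $\#\{A \cap H^-\} \leq \#\{A\}/2$. *)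

theory Defs
  imports "HOL-Analysis.Analysis"
begin

definition hyperplane :: "real ^ 'n \<Rightarrow> real \<Rightarrow> (real ^ 'n) set" where
  "hyperplane u c = {x. u \<bullet> x = c}"

definition pos_halfspace :: "real ^ 'n \<Rightarrow> real \<Rightarrow> (real ^ 'n) set" where
  "pos_halfspace u c = {x. u \<bullet> x > c}"

definition neg_halfspace :: "real ^ 'n \<Rightarrow> real \<Rightarrow> (real ^ 'n) set" where
  "neg_halfspace u c = {x. u \<bullet> x < c}"

text \<open>
  A hyperplane is given by its parameters: a unit normal vector \<open>u\<close> and an offset \<open>c \<ge> 0\<close>.
  They are determined by the point set, except that \<open>u\<close> and \<open>- u\<close> give the same hyperplane
  when \<open>c = 0\<close>; that only swaps the two half-spaces, which leaves bisection unaffected.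
\<close>

definition hyperplane_params :: "real ^ 'n \<Rightarrow> real \<Rightarrow> bool" where
  "hyperplane_params u c \<longleftrightarrow> norm u = 1 \<and> c \<ge> 0"

text \<open>Meaningful for finite \<open>A\<close> only, since \<open>card\<close> is \<open>0\<close> on infinite sets.\<close>

definition bisects :: "real ^ 'n \<Rightarrow> real \<Rightarrow> (real ^ 'n) set \<Rightarrow> bool" where
  "bisects u c A \<longleftrightarrow>
     real (card (A \<inter> pos_halfspace u c)) \<le> real (card A) / 2 \<and>
     real (card (A \<inter> neg_halfspace u c)) \<le> real (card A) / 2"

end

theory Submission
  imports Defs "HOL-Computational_Algebra.Polynomial"
begin

text \<open>
  The theorem is a discrete ham sandwich theorem. The proof below uses no algebraic topology: it
  counts the cuts modulo 2 and follows the count while the points move.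

  Deleting one point from every set of even size makes all the sets odd. If a hyperplane leaves
  less than half of an odd set on either side, it meets that set, and putting the deleted point
  back spoils neither property. So let the colour classes \<open>A\<^sub>j\<close> be odd, and call a choice
  of one point per colour \<^emph>\<open>balanced\<close> if the hyperplane through the chosen points has, in
  every colour, equally many points on its two sides. The parity of the number of balanced
  choices can be computed for points in general position.

  \<^item> The number is \<open>1\<close> for some configuration: put the colour classes one after the other
    on the moment curve. A hyperplane through \<open>n\<close> points of that curve meets it nowhere else and
    crosses it at each of them, hence a choice is balanced only if it consists of the medians
    (\<open>exists_configuration_with_odd_balanced\<close>).

  \<^item> The parity does not change while a single point moves along a generic line. At any
    moment at most one set of \<open>n + 1\<close> points lies in a hyperplane, and this matters only if it
    contains all the colours. Then two of its points \<open>x\<close> and \<open>y\<close> have the same colour, so it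
    yields two choices, one with \<open>x\<close> and one with \<open>y\<close>. Their hyperplanes coincide at that
    moment, hence separate all the other points alike, and the crossing moves \<open>y\<close> across the
    first and \<open>x\<close> across the second. Either neither choice can be balanced, or both change their
    status (\<open>odd_balanced_unchanged_by_crossing\<close>, \<open>odd_balanced_move\<close>).

  Hence the number stays odd. Moving the points one at a time leads from the moment curve to
  configurations in general position arbitrarily close to the given one (\<open>generic_move\<close>,
  \<open>odd_balanced_approximation\<close>). These have balanced choices, and a limit of the corresponding
  hyperplanes halves the given sets, because a point strictly on one side of the limit is
  strictly on that side of hyperplanes near it (\<open>discrete_ham_sandwich_labelled\<close>).
\<close>

section \<open>The side of a point with respect to a hyperplane\<close>

text \<open>
  Up to sign, this is \<open>n!\<close> times the volume of the simplex with vertices \<open>p i\<close> and \<open>x\<close>. As a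
  function of \<open>x\<close> it is affine, and if the \<open>p i\<close> are affinely independent, its sign tells the
  two sides of the hyperplane through them apart. The colours will be the elements of the index
  type of the coordinates, so that one point per colour gives a square matrix.
\<close>
definition orient :: "('n \<Rightarrow> real ^ 'n) \<Rightarrow> real ^ 'n \<Rightarrow> real" where
  "orient p x = det (\<chi> i. p i - x)"

lemma det_subtract_row:
  fixes r :: "'n::finite \<Rightarrow> real ^ 'n"
  assumes "finite S" "j \<notin> S"
  shows "det (\<chi> i. if i \<in> S then r i - r j else r i) = det (\<chi> i. r i)"
  using assms
proof (induction S rule: finite_induct)
  case (insert a S)
  let ?A = "(\<chi> i. if i \<in> S then r i - r j else r i) :: real ^ 'n ^ 'n"
  have "(\<chi> i. if i \<in> insert a S then r i - r j else r i)
        = (\<chi> k. if k = a then row a ?A + (-1) *s row j ?A else row k ?A)"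
    using insert by (auto simp: vec_eq_iff row_def vector_scalar_mult_def)
  with insert show ?case
    by (auto simp: det_row_operation)
qed simp

lemma orient_affine_in_vertex:
  fixes p :: "'n::finite \<Rightarrow> real ^ 'n"
  obtains w d where "\<And>y. orient (p(j := y)) x = w \<bullet> y + d"
proof -
  define L where "L v = det (\<chi> i. if i = j then v else p i - x)" for v :: "real ^ 'n"
  have "linear L"
  proof
    show "L (v + v') = L v + L v'" for v v'
      unfolding L_def using det_row_add[of j "\<lambda>_. v" "\<lambda>_. v'" "\<lambda>i. p i - x"] by simp
    show "L (c *\<^sub>R v) = c *\<^sub>R L v" for c v
      unfolding L_def using det_row_mul[of j c "\<lambda>_. v" "\<lambda>i. p i - x"]
      by (simp add: scalar_mult_eq_scaleR cong: if_cong)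
  qed
  have "orient (p(j := y)) x = adjoint L 1 \<bullet> y + (- L x)" for y
  proof -
    have "orient (p(j := y)) x = L (y - x)"
      unfolding orient_def L_def by (rule arg_cong[where f = det]) (auto simp: vec_eq_iff)
    also have "\<dots> = L y - L x"
      using \<open>linear L\<close> by (rule linear_diff)
    also have "L y = adjoint L 1 \<bullet> y"
      using adjoint_works[OF \<open>linear L\<close>, of y 1] by (simp add: inner_commute)
    finally show ?thesis by (simp only: diff_conv_add_uminus)
  qed
  then show thesis using that by blast
qed

text \<open>
  Exchanging the apex with a vertex subtracts the row of that vertex from all the others and
  changes its sign.
\<close>
lemma orient_swap:
  fixes p :: "'n::finite \<Rightarrow> real ^ 'n"
  shows "orient (p(j := x)) (p j) = - orient p x"
proof -
  define r where "r i = p i - x" for i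
  let ?B = "(\<chi> i. if i \<in> UNIV - {j} then r i - r j else r i) :: real ^ 'n ^ 'n"
  have "(\<chi> i. (p(j := x)) i - p j) = (\<chi> i. if i = j then (-1) *s ?B $ i else ?B $ i)"
    by (auto simp: vec_eq_iff r_def)
  then have "orient (p(j := x)) (p j) = - det ?B"
    unfolding orient_def using det_row_mul[of j "-1" "\<lambda>i. ?B $ i" "\<lambda>i. ?B $ i"]
    by (simp add: vec_lambda_eta)
  also have "det ?B = orient p x"
    using det_subtract_row[of "UNIV - {j}" j r] by (simp add: orient_def r_def)
  finally show ?thesis .
qed

text \<open>
  The apex occurs in every row of the matrix, but after a swap it is an ordinary vertex and
  occurs in only one.
\<close>
lemma orient_affine:
  fixes p :: "'n::finite \<Rightarrow> real ^ 'n"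
  obtains w d where "\<And>x. orient p x = w \<bullet> x + d"
proof -
  fix j :: 'n
  obtain w d where "\<And>y. orient (p(j := y)) (p j) = w \<bullet> y + d"
    using orient_affine_in_vertex[of p j "p j"] by blast
  then have "orient p x = (- w) \<bullet> x + (- d)" for x
    using orient_swap[of p j x] by (simp add: algebra_simps)
  then show thesis using that by blast
qed

lemma orient_vertex [simp]:
  fixes p :: "'n::finite \<Rightarrow> real ^ 'n"
  shows "orient p (p i) = 0"
  unfolding orient_def by (rule det_zero_row(1)[of i]) (simp add: row_def vec_eq_iff)

lemma orient_eq_0_iff:
  fixes p :: "'n::finite \<Rightarrow> real ^ 'n"
  shows "orient p x = 0 \<longleftrightarrow> (\<exists>u. norm u = 1 \<and> (\<forall>i. u \<bullet> p i = u \<bullet> x))"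
proof -
  let ?M = "(\<chi> i. p i - x) :: real ^ 'n ^ 'n"
  have *: "?M *v u = 0 \<longleftrightarrow> (\<forall>i. u \<bullet> p i = u \<bullet> x)" for u
    by (simp add: vec_eq_iff matrix_vector_mul_component inner_diff_left inner_commute[of u])
  have "orient p x = 0 \<longleftrightarrow> (\<exists>u. ?M *v u = 0 \<and> u \<noteq> 0)"
    unfolding orient_def using invertible_det_nz[of ?M] matrix_left_invertible_ker[of ?M]
      invertible_left_inverse[of ?M] by blast
  also have "\<dots> \<longleftrightarrow> (\<exists>u. norm u = 1 \<and> (\<forall>i. u \<bullet> p i = u \<bullet> x))"
  proof
    assume "\<exists>u. ?M *v u = 0 \<and> u \<noteq> 0"
    then obtain u where "\<forall>i. u \<bullet> p i = u \<bullet> x" "u \<noteq> 0" using * by blast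
    then have "norm (sgn u) = 1 \<and> (\<forall>i. sgn u \<bullet> p i = sgn u \<bullet> x)"
      by (simp add: norm_sgn) (simp add: sgn_div_norm)
    then show "\<exists>u. norm u = 1 \<and> (\<forall>i. u \<bullet> p i = u \<bullet> x)" by blast
  next
    assume "\<exists>u. norm u = 1 \<and> (\<forall>i. u \<bullet> p i = u \<bullet> x)"
    then show "\<exists>u. ?M *v u = 0 \<and> u \<noteq> 0" using * by (metis norm_zero zero_neq_one)
  qed
  finally show ?thesis .
qed

text \<open>
  An affine function that vanishes on a hyperplane is a multiple of the height above it. The
  factor is \<open>0\<close> if the \<open>p i\<close> are affinely dependent.
\<close>
lemma orient_eq_multiple:
  fixes p :: "'n::finite \<Rightarrow> real ^ 'n"
  assumes u: "norm u = 1" and p: "\<And>i. u \<bullet> p i = c"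
  obtains a where "\<And>x. orient p x = a * (u \<bullet> x - c)"
proof -
  obtain w d where w: "\<And>x. orient p x = w \<bullet> x + d" using orient_affine by blast
  have "orient p x = (w \<bullet> u) * (u \<bullet> x - c)" for x
  proof -
    define y where "y = x - (u \<bullet> x - c) *\<^sub>R u"
    have "u \<bullet> u = 1" using u by (simp add: norm_eq_1)
    then have "u \<bullet> y = c" by (simp add: y_def inner_diff_right)
    then have "orient p y = 0" unfolding orient_eq_0_iff using u p by auto
    then have "w \<bullet> y + d = 0" by (simp add: w)
    then show ?thesis by (simp add: w y_def inner_diff_right algebra_simps)
  qed
  then show thesis using that by blast
qed

lemma hyperplane_through_vertices:
  fixes p :: "'n::finite \<Rightarrow> real ^ 'n"
  obtains u c where "norm u = 1" "\<And>i. u \<bullet> p i = c"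
  using orient_vertex[of p undefined] unfolding orient_eq_0_iff by blast

section \<open>General position and generic motions\<close>

text \<open>
  The points are labelled, so that they may coincide and may move. A pair \<open>p\<close>, \<open>y\<close> as below
  lists \<open>n + 1\<close> distinct labels with a distinguished last one.
\<close>
definition simplex_labels :: "'l set \<Rightarrow> ('n \<Rightarrow> 'l) \<Rightarrow> 'l \<Rightarrow> bool" where
  "simplex_labels I p y \<longleftrightarrow> inj p \<and> range p \<subseteq> I \<and> y \<in> I \<and> y \<notin> range p"

definition general_position :: "'l set \<Rightarrow> ('l \<Rightarrow> real ^ 'n) \<Rightarrow> bool" where
  "general_position I X \<longleftrightarrow>
     (\<forall>(p :: 'n \<Rightarrow> 'l) y. simplex_labels I p y \<longrightarrow> orient (X \<circ> p) (X y) \<noteq> 0)"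

lemma general_positionD:
  "general_position I X \<Longrightarrow> simplex_labels I p y \<Longrightarrow> orient (X \<circ> p) (X y) \<noteq> 0"
  for X :: "'l \<Rightarrow> real ^ 'n"
  by (simp add: general_position_def)

text \<open>
  Choosing another label of a simplex as the last one affects the orientation only by a sign. A
  simplex that contains a moving point can thus be described by its fixed facet.
\<close>
lemma simplex_labels_moved_last:
  fixes p :: "'n::finite \<Rightarrow> 'l"
  assumes py: "simplex_labels I p y" and z: "z \<in> insert y (range p)"
  obtains p' :: "'n \<Rightarrow> 'l" and \<sigma> :: real
  where "simplex_labels I p' z" "insert z (range p') = insert y (range p)" "\<sigma> \<noteq> 0"
    "\<And>X x. orient (X(z := x) \<circ> p) ((X(z := x)) y) = \<sigma> * orient (X \<circ> p') (x :: real ^ 'n)"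
proof (cases "z = y")
  case True
  have "X(z := x) \<circ> p = X \<circ> p" for X and x :: "real ^ 'n"
    using py True by (auto simp: fun_eq_iff simplex_labels_def)
  then show thesis using that[of p 1] py True by simp
next
  case False
  with z obtain j where j: "z = p j" by blast
  define p' where "p' = p(j := y)"
  have inj: "inj p" and y: "y \<notin> range p" and I: "range p \<subseteq> I" "y \<in> I"
    using py by (auto simp: simplex_labels_def)
  have "inj p'" using inj y unfolding p'_def by (intro inj_on_fun_updI) auto
  moreover have r: "range p' = insert y (range p - {p j})"
    using inj unfolding p'_def by (auto simp: inj_def fun_upd_def split: if_splits)
  ultimately have "simplex_labels I p' z"
    using I j y by (auto simp: simplex_labels_def)
  moreover have "insert z (range p') = insert y (range p)"
    using r j by auto
  moreover have "orient (X(z := x) \<circ> p) ((X(z := x)) y) = - 1 * orient (X \<circ> p') x"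
    for X and x :: "real ^ 'n"
  proof -
    have "(X(z := x) \<circ> p)(j := X y) = X \<circ> p'"
      using inj j by (auto simp: fun_eq_iff p'_def inj_def)
    then show ?thesis
      using orient_swap[of "X(z := x) \<circ> p" j "X y"] j False by simp
  qed
  ultimately show thesis by (intro that[of p' "-1"]) auto
qed

text \<open>
  The zero sets are hyperplanes or empty, and finitely many of them cannot cover a ball.
\<close>
lemma affine_functions_common_nonzero:
  fixes F :: "('a::euclidean_space \<Rightarrow> real) set"
  assumes "finite F" and affine: "\<And>g. g \<in> F \<Longrightarrow> \<exists>w d. \<forall>x. g x = w \<bullet> x + d"
    and nz: "\<And>g. g \<in> F \<Longrightarrow> \<exists>x. g x \<noteq> 0" and "\<epsilon> > 0"
  obtains q where "dist q z < \<epsilon>" "\<And>g. g \<in> F \<Longrightarrow> g q \<noteq> 0"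
proof -
  have "negligible {x. g x = 0}" if "g \<in> F" for g
  proof -
    obtain w d where g: "\<And>x. g x = w \<bullet> x + d" using affine[OF \<open>g \<in> F\<close>] by blast
    have "w \<noteq> 0 \<or> - d \<noteq> 0" using nz[OF that] g by auto
    from negligible_hyperplane[OF this] show ?thesis
      by (simp add: g eq_neg_iff_add_eq_0)
  qed
  then have "negligible (\<Union>g\<in>F. {x. g x = 0})"
    using \<open>finite F\<close> by (intro negligible_Union) auto
  moreover have "\<not> negligible (ball z \<epsilon>)"
    using \<open>\<epsilon> > 0\<close> by (intro open_not_negligible) auto
  ultimately have "\<not> ball z \<epsilon> \<subseteq> (\<Union>g\<in>F. {x. g x = 0})"
    using negligible_subset by blast
  then obtain q where "q \<in> ball z \<epsilon>" "q \<notin> (\<Union>g\<in>F. {x. g x = 0})" by blast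
  then show thesis by (intro that[of q]) (auto simp: dist_commute)
qed

definition move :: "('l \<Rightarrow> real ^ 'n) \<Rightarrow> 'l \<Rightarrow> real ^ 'n \<Rightarrow> real \<Rightarrow> 'l \<Rightarrow> real ^ 'n" where
  "move X z q t = X(z := X z + t *\<^sub>R (q - X z))"

lemma move_0 [simp]: "move X z q 0 = X" and move_1 [simp]: "move X z q 1 = X(z := q)"
  by (simp_all add: move_def)

lemma orient_move_affine:
  fixes p :: "'n::finite \<Rightarrow> 'l"
  assumes "simplex_labels I p y"
  obtains a b where "\<And>t. orient (move X z q t \<circ> p) (move X z q t y) = a + b * t"
proof (cases "z \<in> insert y (range p)")
  case True
  from simplex_labels_moved_last[OF assms True]
  obtain p' :: "'n \<Rightarrow> 'l" and \<sigma> :: real where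
    p': "\<And>X x. orient (X(z := x) \<circ> p) ((X(z := x)) y) = \<sigma> * orient (X \<circ> p') x"
    by metis
  obtain w d where w: "\<And>x. orient (X \<circ> p') x = w \<bullet> x + d"
    using orient_affine by blast
  show thesis
    by (rule that[of "\<sigma> * (w \<bullet> X z + d)" "\<sigma> * (w \<bullet> (q - X z))"])
      (unfold move_def p' w, simp add: inner_add_right algebra_simps)
next
  case False
  then have "move X z q t \<circ> p = X \<circ> p" "move X z q t y = X y" for t
    by (auto simp: move_def fun_eq_iff)
  then show thesis by (intro that[of "orient (X \<circ> p) (X y)" 0]) simp
qed

text \<open>
  The position \<open>q\<close> has to avoid the hyperplanes spanned by the fixed points, which is the
  general position of the new configuration, and the line from \<open>a = X z\<close> to \<open>q\<close> must not meet
  two different ones of these hyperplanes in the same point. For facets \<open>p\<close> and \<open>p'\<close> with height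
  functions \<open>G p\<close> and \<open>G p'\<close>, a common zero on the line forces
  \<open>G p a * G p' q = G p' a * G p q\<close>. This is an affine equation for \<open>q\<close>. It is not an identity:
  a vertex of \<open>p\<close> that does not belong to \<open>p'\<close> violates it, by general position. So the bad
  positions \<open>q\<close> lie on finitely many hyperplanes. Two simplices that degenerate at the same time
  therefore have the same vertices.
\<close>
lemma generic_move:
  fixes X :: "'l \<Rightarrow> real ^ 'n::finite"
  assumes "finite I" and gp: "general_position I X" and "z \<in> I" and "\<epsilon> > 0"
  obtains q where "dist q x < \<epsilon>" "general_position I (X(z := q))"
    "\<And>t (p :: 'n \<Rightarrow> 'l) y p' y'. simplex_labels I p y \<Longrightarrow> orient (move X z q t \<circ> p) (move X z q t y) = 0 \<Longrightarrow>
       simplex_labels I p' y' \<Longrightarrow> orient (move X z q t \<circ> p') (move X z q t y') = 0 \<Longrightarrow>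
       insert y (range p) = insert y' (range p')"
proof -
  define P where "P = {p :: 'n \<Rightarrow> 'l. simplex_labels I p z}"
  define G where "G p = orient (X \<circ> p)" for p :: "'n \<Rightarrow> 'l"
  let ?a = "X z"
  have "P \<subseteq> UNIV \<rightarrow>\<^sub>E I" by (auto simp: P_def simplex_labels_def)
  then have "finite P" using \<open>finite I\<close> by (meson finite finite_PiE finite_subset)
  have nz: "G p ?a \<noteq> 0" if "p \<in> P" for p
    using gp that by (auto simp: general_position_def P_def G_def)
  have "\<exists>w d. \<forall>x. G p x = w \<bullet> x + d" for p
    using orient_affine[of "X \<circ> p"] unfolding G_def by metis
  then obtain w d where G: "\<And>p x. G p x = w p \<bullet> x + d p" by metis
  define K where "K = {(p, p'). p \<in> P \<and> p' \<in> P \<and> range p \<noteq> range p'}"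
  define L where "L = (\<lambda>(p, p') x. G p ?a * G p' x - G p' ?a * G p x)"
  have L_affine: "\<exists>w d. \<forall>x. L k x = w \<bullet> x + d" for k
  proof -
    obtain p p' where k: "k = (p, p')" by (cases k)
    have "L k x = (G p ?a *\<^sub>R w p' - G p' ?a *\<^sub>R w p) \<bullet> x + (G p ?a * d p' - G p' ?a * d p)" for x
      by (simp add: L_def k G[of _ x] inner_diff_left algebra_simps)
    then show ?thesis by blast
  qed
  have L_nz: "\<exists>x. L k x \<noteq> 0" if "k \<in> K" for k
  proof -
    obtain p p' where k: "k = (p, p')" "p \<in> P" "p' \<in> P" "range p \<noteq> range p'"
      using \<open>k \<in> K\<close> unfolding K_def by blast
    have "card (range p) = card (range p')"
      using k by (simp add: P_def simplex_labels_def card_image)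
    then have "\<not> range p \<subseteq> range p'"
      using k(4) card_subset_eq[of "range p'" "range p"] by auto
    then obtain i where i: "p i \<notin> range p'" by blast
    have "p i \<in> I" using k(2) by (auto simp: P_def simplex_labels_def)
    then have "simplex_labels I p' (p i)"
      using k(3) i by (simp add: P_def simplex_labels_def)
    then have "G p' (X (p i)) \<noteq> 0"
      using gp by (simp add: general_position_def G_def)
    moreover have "G p (X (p i)) = 0"
      using orient_vertex[of "X \<circ> p" i] by (simp add: G_def)
    ultimately show ?thesis using nz[OF k(2)] k(1)
      by (intro exI[of _ "X (p i)"]) (simp add: L_def)
  qed
  have "finite K"
    by (rule finite_subset[of _ "P \<times> P"]) (use \<open>finite P\<close> in \<open>auto simp: K_def\<close>)
  \<comment> \<open>The functions in \<open>L ` K\<close> exclude simultaneous degenerations, those in \<open>G ` P\<close> degenerate end points.\<close>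
  obtain q where q: "dist q x < \<epsilon>" and q': "\<And>g. g \<in> G ` P \<union> L ` K \<Longrightarrow> g q \<noteq> 0"
  proof (rule affine_functions_common_nonzero[of "G ` P \<union> L ` K" \<epsilon> x])
    show "finite (G ` P \<union> L ` K)" using \<open>finite P\<close> \<open>finite K\<close> by simp
    show "\<exists>w d. \<forall>x. g x = w \<bullet> x + d" if "g \<in> G ` P \<union> L ` K" for g
      using that L_affine G by blast
    show "\<exists>x. g x \<noteq> 0" if "g \<in> G ` P \<union> L ` K" for g
      using that L_nz nz by blast
  qed (use \<open>\<epsilon> > 0\<close> in blast)+
  have q1: "G p q \<noteq> 0" if "p \<in> P" for p
    using q' that by blast
  have q2: "G p ?a * G p' q - G p' ?a * G p q \<noteq> 0" if "(p, p') \<in> K" for p p'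
  proof -
    have "L (p, p') q \<noteq> 0" using q' that by blast
    then show ?thesis by (simp add: L_def)
  qed
  show thesis
  proof (rule that)
    show "dist q x < \<epsilon>" by fact
    show "general_position I (X(z := q))"
      unfolding general_position_def
    proof (intro allI impI)
      fix p :: "'n \<Rightarrow> 'l" and y assume py: "simplex_labels I p y"
      show "orient (X(z := q) \<circ> p) ((X(z := q)) y) \<noteq> 0"
      proof (cases "z \<in> insert y (range p)")
        case True
        from simplex_labels_moved_last[OF py True]
        obtain p' :: "'n \<Rightarrow> 'l" and \<sigma> :: real where p': "simplex_labels I p' z" "\<sigma> \<noteq> 0"
          "\<And>X x. orient (X(z := x) \<circ> p) ((X(z := x)) y) = \<sigma> * orient (X \<circ> p') x"
          by metis
        then show ?thesis using q1[of p'] by (simp add: P_def G_def)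
      next
        case False
        then have "X(z := q) \<circ> p = X \<circ> p" "(X(z := q)) y = X y"
          by (auto simp: fun_eq_iff)
        then show ?thesis using gp py by (simp add: general_position_def)
      qed
    qed
  next
    fix t :: real and p :: "'n \<Rightarrow> 'l" and y p' y'
    have reduce: "\<exists>r\<in>P. insert z (range r) = insert y (range p) \<and> G r (?a + t *\<^sub>R (q - ?a)) = 0"
      if py: "simplex_labels I p y" and 0: "orient (move X z q t \<circ> p) (move X z q t y) = 0"
      for p :: "'n \<Rightarrow> 'l" and y
    proof (cases "z \<in> insert y (range p)")
      case True
      from simplex_labels_moved_last[OF py True]
      obtain r :: "'n \<Rightarrow> 'l" and \<sigma> :: real where r: "simplex_labels I r z"
        "insert z (range r) = insert y (range p)" "\<sigma> \<noteq> 0"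
        "\<And>X x. orient (X(z := x) \<circ> p) ((X(z := x)) y) = \<sigma> * orient (X \<circ> r) x"
        by metis
      then show ?thesis using 0 by (auto simp: P_def G_def move_def)
    next
      case False
      then have "move X z q t \<circ> p = X \<circ> p" "move X z q t y = X y"
        by (auto simp: move_def fun_eq_iff)
      then show ?thesis using 0 gp py by (simp add: general_position_def)
    qed
    assume py: "simplex_labels I p y" "orient (move X z q t \<circ> p) (move X z q t y) = 0"
      and py': "simplex_labels I p' y'" "orient (move X z q t \<circ> p') (move X z q t y') = 0"
    from reduce[OF py] obtain r where r: "r \<in> P" "insert z (range r) = insert y (range p)"
      "G r (?a + t *\<^sub>R (q - ?a)) = 0" by blast
    from reduce[OF py'] obtain r' where r': "r' \<in> P" "insert z (range r') = insert y' (range p')"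
      "G r' (?a + t *\<^sub>R (q - ?a)) = 0" by blast
    have line: "G s (?a + t *\<^sub>R (q - ?a)) = (1 - t) * G s ?a + t * G s q" for s
      by (simp add: G inner_add_right inner_diff_right algebra_simps)
    have "t \<noteq> 0" using nz[OF r(1)] r(3) by auto
    \<comment> \<open>A common zero of \<open>G r\<close> and \<open>G r'\<close> on the line makes \<open>q\<close> a zero of \<open>L (r, r')\<close>.\<close>
    have "t * (G r ?a * G r' q - G r' ?a * G r q)
        = G r ?a * ((1 - t) * G r' ?a + t * G r' q) - G r' ?a * ((1 - t) * G r ?a + t * G r q)"
      by (simp add: algebra_simps)
    also have "\<dots> = 0" using r(3) r'(3) by (simp add: line)
    finally have "(r, r') \<notin> K" using q2 \<open>t \<noteq> 0\<close> by auto
    then have "range r = range r'" using r(1) r'(1) by (auto simp: K_def)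
    then show "insert y (range p) = insert y' (range p')" using r(2) r'(2) by simp
  qed
qed

text \<open>
  Along a line orientations are affine functions of time, and they do not vanish at time \<open>0\<close>.
  Shortly before and after a given time they do not vanish, and those that do not vanish at that
  time keep their sign.
\<close>
lemma eventually_affine_sgn:
  fixes a b t0 :: real
  assumes "a \<noteq> 0"
  shows "\<forall>\<^sub>F t in at t0. a + b * t \<noteq> 0 \<and> (a + b * t0 \<noteq> 0 \<longrightarrow> sgn (a + b * t) = sgn (a + b * t0))"
proof (cases "a + b * t0 = 0")
  case True
  then have "b \<noteq> 0" using assms by auto
  have "\<forall>\<^sub>F t in at t0. t \<noteq> t0" by (simp add: eventually_neq_at_within)
  then show ?thesis
  proof eventually_elim
    case (elim t)
    have "a + b * t = b * (t - t0)" using True by (simp add: algebra_simps)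
    then show ?case using elim True \<open>b \<noteq> 0\<close> by simp
  qed
next
  case False
  have lim: "((\<lambda>t. a + b * t) \<longlongrightarrow> a + b * t0) (at t0)" by (intro tendsto_intros)
  consider "a + b * t0 > 0" | "a + b * t0 < 0" using False by linarith
  then show ?thesis
  proof cases
    case 1
    from order_tendstoD(1)[OF lim 1] show ?thesis
      by eventually_elim (use 1 in \<open>simp add: sgn_if\<close>)
  next
    case 2
    from order_tendstoD(2)[OF lim 2] show ?thesis
      by eventually_elim (use 2 in \<open>simp add: sgn_if\<close>)
  qed
qed

section \<open>Balanced choices of one point per colour\<close>
definition labels :: "('n \<Rightarrow> nat) \<Rightarrow> ('n \<times> nat) set" where
  "labels m = (SIGMA i : UNIV. {..<m i})"

definition graph :: "('n \<Rightarrow> nat) \<Rightarrow> 'n \<Rightarrow> 'n \<times> nat" where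
  "graph s i = (i, s i)"

definition selections :: "('n \<Rightarrow> nat) \<Rightarrow> ('n \<Rightarrow> nat) set" where
  "selections m = {s. \<forall>i. s i < m i}"

text \<open>
  The chosen point itself lies on the hyperplane and contributes \<open>0\<close>. If the chosen points are
  affinely dependent, all orientations vanish and the choice counts as balanced.
\<close>
definition balanced :: "('n \<Rightarrow> nat) \<Rightarrow> ('n \<times> nat \<Rightarrow> real ^ 'n) \<Rightarrow> ('n \<Rightarrow> nat) set" where
  "balanced m X = {s \<in> selections m. \<forall>j. (\<Sum>k<m j. sgn (orient (X \<circ> graph s) (X (j, k)))) = 0}"

lemma mem_labels [simp]: "(j, k) \<in> labels m \<longleftrightarrow> k < m j"
  by (simp add: labels_def)

lemma finite_labels: "finite (labels m)" for m :: "'n::finite \<Rightarrow> nat"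
  by (simp add: labels_def)

lemma finite_selections: "finite (selections m)" for m :: "'n::finite \<Rightarrow> nat"
proof (rule finite_subset)
  show "selections m \<subseteq> (PiE UNIV (\<lambda>i. {..<m i}))" by (auto simp: selections_def)
qed (simp add: finite_PiE)

lemma finite_balanced: "finite (balanced m X)" for m :: "'n::finite \<Rightarrow> nat"
  using finite_selections[of m] by (auto simp: balanced_def)

lemma inj_graph [simp]: "inj (graph s)"
  by (auto simp: inj_def graph_def)

lemma orient_graph_same [simp]:
  "orient (X \<circ> graph s) (X (i, s i)) = 0" for X :: "'n::finite \<times> nat \<Rightarrow> real ^ 'n"
  using orient_vertex[of "X \<circ> graph s" i] by (simp add: graph_def)

lemma simplex_labels_graph:
  "simplex_labels (labels m) (graph s) (j, k) \<longleftrightarrow> s \<in> selections m \<and> k < m j \<and> k \<noteq> s j"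
  by (auto simp: simplex_labels_def selections_def labels_def graph_def)

text \<open>
  A set of \<open>n + 1\<close> labels that contains all the colours has exactly one repeated colour, hence
  exactly two descriptions as a choice together with an additional label.
\<close>
lemma insert_graph_eq_cases:
  assumes eq: "insert (j, k) (range (graph s)) = insert (j', k') (range (graph s'))"
    and ne: "k \<noteq> s j" "k' \<noteq> s' j'"
  shows "j' = j \<and> (s' = s \<and> k' = k \<or> s' = s(j := k) \<and> k' = s j)"
proof -
  have mem: "(i, l) \<in> insert (j, k) (range (graph s)) \<longleftrightarrow> l = s i \<or> i = j \<and> l = k" for i l
    by (auto simp: graph_def)
  have mem': "(i, l) \<in> insert (j', k') (range (graph s')) \<longleftrightarrow> l = s' i \<or> i = j' \<and> l = k'" for i l
    by (auto simp: graph_def)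
  have *: "l = s i \<or> i = j \<and> l = k \<longleftrightarrow> l = s' i \<or> i = j' \<and> l = k'" for i l
    using mem mem' eq by metis
  have "j' = j" using *[of "s' j'" j'] *[of k' j'] ne by auto
  moreover have "s' i = s i" if "i \<noteq> j" for i
    using *[of "s i" i] that \<open>j' = j\<close> by auto
  moreover have "s' j = s j \<and> k' = k \<or> s' j = k \<and> k' = s j"
    using *[of "s j" j] *[of k j] ne \<open>j' = j\<close> by auto
  ultimately show ?thesis using \<open>j' = j\<close> by (metis ext fun_upd_apply)
qed

lemma odd_card_eq_if_agree_off_pair:
  assumes "finite C" "finite C'" "a \<noteq> b"
    and "\<And>s. s \<noteq> a \<Longrightarrow> s \<noteq> b \<Longrightarrow> s \<in> C \<longleftrightarrow> s \<in> C'"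
    and "(a \<in> C \<longleftrightarrow> b \<in> C) \<longleftrightarrow> (a \<in> C' \<longleftrightarrow> b \<in> C')"
  shows "odd (card C) \<longleftrightarrow> odd (card C')"
proof -
  have split: "card B = card (B - {a, b}) + card (B \<inter> {a, b})" if "finite B" for B
    using card_Int_Diff[OF that, of "{a, b}"] by simp
  have odd: "odd (card (B \<inter> {a, b})) \<longleftrightarrow> \<not> (a \<in> B \<longleftrightarrow> b \<in> B)" for B
  proof -
    have "B \<inter> {a, b} = (if a \<in> B then {a} else {}) \<union> (if b \<in> B then {b} else {})" by auto
    then show ?thesis using \<open>a \<noteq> b\<close> by auto
  qed
  have "C - {a, b} = C' - {a, b}" using assms(4) by auto
  then show ?thesis using split[OF assms(1)] split[OF assms(2)] odd[of C] odd[of C'] assms(5) by simp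
qed

section \<open>Crossing a degenerate configuration\<close>

text \<open>
  \<open>X\<close> is nondegenerate and its orientations agree with those of \<open>Y\<close> where the latter do not
  vanish: a small perturbation of \<open>Y\<close>, described without a distance.
\<close>
definition resolves :: "('n \<Rightarrow> nat) \<Rightarrow> ('n \<times> nat \<Rightarrow> real ^ 'n) \<Rightarrow> ('n \<times> nat \<Rightarrow> real ^ 'n) \<Rightarrow> bool" where
  "resolves m X Y \<longleftrightarrow> (\<forall>s j k. simplex_labels (labels m) (graph s) (j, k) \<longrightarrow>
     orient (X \<circ> graph s) (X (j, k)) \<noteq> 0 \<and>
     (orient (Y \<circ> graph s) (Y (j, k)) \<noteq> 0 \<longrightarrow>
      sgn (orient (X \<circ> graph s) (X (j, k))) = sgn (orient (Y \<circ> graph s) (Y (j, k)))))"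

text \<open>
  If \<open>x\<close> lies on a hyperplane through the points \<open>p i\<close>, then replacing one of these points by
  \<open>x\<close> gives points of that hyperplane again.
\<close>
lemma orient_proportional_if_degenerate:
  fixes p :: "'n::finite \<Rightarrow> real ^ 'n"
  assumes "orient p x = 0"
  obtains a b f where "\<And>z. orient p z = a * f z" "\<And>z. orient (p(j := x)) z = b * f z"
proof -
  from assms obtain u where u: "norm u = 1" "\<And>i. u \<bullet> p i = u \<bullet> x"
    unfolding orient_eq_0_iff by blast
  then have u': "u \<bullet> (p(j := x)) i = u \<bullet> x" for i by simp
  obtain a where a: "\<And>z. orient p z = a * (u \<bullet> z - u \<bullet> x)"
    using orient_eq_multiple[where p = p, OF u] by blast
  obtain b where b: "\<And>z. orient (p(j := x)) z = b * (u \<bullet> z - u \<bullet> x)"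
    using orient_eq_multiple[where p = "p(j := x)", OF u(1) u'] by blast
  show thesis by (rule that[OF a b])
qed

text \<open>
  Let \<open>s\<close> and \<open>s'\<close> be the two choices contained in the only degenerate simplex of \<open>Y\<close>, and \<open>j\<close>
  their repeated colour. All the other choices are balanced in \<open>X\<close> if and only if they are in
  \<open>X'\<close>. In \<open>Y\<close> the hyperplanes of \<open>s\<close> and \<open>s'\<close> coincide, so their orientations differ by a fixed
  factor \<open>\<rho> = \<plusminus>1\<close>. Let \<open>T\<close> be the excess of the positive side of \<open>s\<close> in colour
  \<open>j\<close>, not counting the two repeated points, and let \<open>\<sigma>\<close> be the sign of the point of \<open>s'\<close>
  relative to \<open>s\<close> after a perturbation. By antisymmetry the point of \<open>s\<close> has the sign
  \<open>- \<sigma>\<close> relative to \<open>s'\<close>. The balance conditions in colour \<open>j\<close> are therefore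
  \<open>\<sigma> + T = 0\<close> and \<open>- \<sigma> + \<rho> * T = 0\<close>. Whether they are equivalent depends on
  \<open>\<rho>\<close> and \<open>T\<close> but not on \<open>\<sigma>\<close>, hence neither does the parity of the number of
  balanced choices among \<open>s\<close> and \<open>s'\<close>. The size of colour class \<open>j\<close> is odd, so it contains a
  third point. It witnesses that the facets are nondegenerate in \<open>Y\<close>.
\<close>
lemma odd_balanced_unchanged_by_crossing:
  fixes X X' Y :: "'n::finite \<times> nat \<Rightarrow> real ^ 'n"
  assumes odd: "\<And>j. odd (m j)"
    and X: "resolves m X Y" and X': "resolves m X' Y"
    and unique: "\<And>s j k s' j' k'.
      simplex_labels (labels m) (graph s) (j, k) \<Longrightarrow> orient (Y \<circ> graph s) (Y (j, k)) = 0 \<Longrightarrow>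
      simplex_labels (labels m) (graph s') (j', k') \<Longrightarrow> orient (Y \<circ> graph s') (Y (j', k')) = 0 \<Longrightarrow>
      insert (j, k) (range (graph s)) = insert (j', k') (range (graph s'))"
  shows "odd (card (balanced m X)) \<longleftrightarrow> odd (card (balanced m X'))"
proof -
  define S where "S Z s j k = sgn (orient (Z \<circ> graph s) (Z (j, k)))"
    for Z :: "'n \<times> nat \<Rightarrow> real ^ 'n" and s j k
  have bal: "s \<in> balanced m Z \<longleftrightarrow> s \<in> selections m \<and> (\<forall>j. (\<Sum>k<m j. S Z s j k) = 0)" for Z s
    by (simp add: balanced_def S_def)
  have self: "S Z s j (s j) = 0" for Z s j by (simp add: S_def)
  have unique': "j' = j \<and> (s' = s \<and> k' = k \<or> s' = s(j := k) \<and> k' = s j)"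
    if "s \<in> selections m" "k < m j" "k \<noteq> s j" "s' \<in> selections m" "k' < m j'" "k' \<noteq> s' j'"
      "S Y s j k = 0" "S Y s' j' k' = 0" for s j k s' j' k'
    using unique[of s j k s' j' k'] that
    by (intro insert_graph_eq_cases) (simp_all add: S_def simplex_labels_graph sgn_zero_iff)
  have res: "S Z s j k \<noteq> 0 \<and> (S Y s j k \<noteq> 0 \<longrightarrow> S Z s j k = S Y s j k)"
    if "resolves m Z Y" "s \<in> selections m" "k < m j" "k \<noteq> s j" for Z s j k
    using that by (simp add: resolves_def S_def simplex_labels_graph sgn_zero_iff)
  show ?thesis
  proof (cases "\<exists>s j k. s \<in> selections m \<and> k < m j \<and> k \<noteq> s j \<and> S Y s j k = 0")
    case False
    then have "S Z s j k = S Y s j k" if "resolves m Z Y" "s \<in> selections m" "k < m j" for Z s j k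
      using res[of Z s k j] self that by metis
    then have "balanced m X = balanced m X'" using X X' by (auto simp: bal)
    then show ?thesis by simp
  next
    case True
    then obtain s j k where s: "s \<in> selections m" "k < m j" "k \<noteq> s j" "S Y s j k = 0" by blast
    define s' where "s' = s(j := k)"
    have s': "s' \<in> selections m" "s j < m j" "s j \<noteq> s' j" "s' j = k"
      using s by (auto simp: s'_def selections_def)
    have keep: "S Z r i l = S Y r i l"
      if "resolves m Z Y" "r \<in> selections m" "l < m i"
        "\<not> (i = j \<and> (r = s \<and> l = k \<or> r = s' \<and> l = s j))" for Z r i l
    proof (cases "l = r i")
      case False
      have "S Y r i l \<noteq> 0"
      proof
        assume "S Y r i l = 0"
        from unique'[OF s(1-3) that(2,3) False s(4) this] that(4)
        show False unfolding s'_def by blast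
      qed
      then show ?thesis using res[OF that(1-3) False] by simp
    qed (simp add: self)
    have off: "r \<in> balanced m X \<longleftrightarrow> r \<in> balanced m X'" if "r \<noteq> s" "r \<noteq> s'" for r
    proof -
      have "S X r i l = S X' r i l" if "r \<in> selections m" "l < m i" for i l
        using keep[OF X that] keep[OF X' that] \<open>r \<noteq> s\<close> \<open>r \<noteq> s'\<close> by simp
      then show ?thesis by (auto simp: bal)
    qed
    let ?K = "{..<m j} - {s j, k}"
    have "orient (Y \<circ> graph s) (Y (j, k)) = 0"
      using s(4) by (simp add: S_def sgn_zero_iff)
    moreover have "(Y \<circ> graph s)(j := Y (j, k)) = Y \<circ> graph s'"
      by (auto simp: fun_eq_iff graph_def s'_def)
    ultimately obtain a b f where ab: "\<And>z. orient (Y \<circ> graph s) z = a * f z"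
      "\<And>z. orient (Y \<circ> graph s') z = b * f z"
      using orient_proportional_if_degenerate[of "Y \<circ> graph s" "Y (j, k)" j] by metis
    \<comment> \<open>A class of two points would consist of the repeated points alone; oddness excludes it.\<close>
    have "?K \<noteq> {}"
    proof
      assume "?K = {}"
      then have "{..<m j} = {s j, k}" using s s' by auto
      then have "card {..<m j} = 2" using s(3) by simp
      then show False using odd[of j] by simp
    qed
    then obtain l where l: "l < m j" "l \<noteq> s j" "l \<noteq> k" by blast
    have "S Y s j l \<noteq> 0" "S Y s' j l \<noteq> 0"
      using unique'[OF s(1-3) s(1) l(1,2) s(4)] unique'[OF s(1-3) s'(1) l(1) _ s(4)] s' l by auto
    then have "a \<noteq> 0" "b \<noteq> 0" by (auto simp: S_def ab)
    define \<rho> where "\<rho> = sgn a * sgn b"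
    have \<rho>: "\<rho> = 1 \<or> \<rho> = -1" using \<open>a \<noteq> 0\<close> \<open>b \<noteq> 0\<close> by (auto simp: \<rho>_def sgn_if)
    have SY: "S Y s' i l = \<rho> * S Y s i l" for i l
      using \<open>a \<noteq> 0\<close> by (simp add: S_def ab \<rho>_def sgn_mult)
    define T where "T = (\<Sum>l\<in>?K. S Y s j l)"
    have pair: "(s \<in> balanced m Z \<longleftrightarrow> s' \<in> balanced m Z) \<longleftrightarrow>
        \<not> (\<forall>i. i \<noteq> j \<longrightarrow> (\<Sum>l<m i. S Y s i l) = 0) \<or> \<bar>T\<bar> \<noteq> 1 \<or> \<rho> = -1"
      if Z: "resolves m Z Y" for Z
    proof -
      define \<sigma> where "\<sigma> = S Z s j k"
      have "\<sigma> \<noteq> 0" using res[OF Z s(1-3)] by (simp add: \<sigma>_def)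
      then have \<sigma>: "\<sigma> = 1 \<or> \<sigma> = -1" by (auto simp: \<sigma>_def S_def sgn_if split: if_splits)
      have swap: "S Z s' j (s j) = - \<sigma>"
      proof -
        have "(Z \<circ> graph s)(j := Z (j, k)) = Z \<circ> graph s'"
          by (auto simp: fun_eq_iff graph_def s'_def)
        moreover have "(Z \<circ> graph s) j = Z (j, s j)" by (simp add: graph_def)
        ultimately show ?thesis
          using orient_swap[of "Z \<circ> graph s" j "Z (j, k)"] by (simp add: S_def \<sigma>_def sgn_minus)
      qed
      have split: "(\<Sum>l<m j. h l) = h (s j) + h k + (\<Sum>l\<in>?K. h l)" for h :: "nat \<Rightarrow> real"
      proof -
        have "{..<m j} = insert (s j) (insert k ?K)" using s s' by auto
        then have "(\<Sum>l<m j. h l) = (\<Sum>l\<in>insert (s j) (insert k ?K). h l)" by simp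
        also have "\<dots> = h (s j) + h k + (\<Sum>l\<in>?K. h l)" using s(3) by simp
        finally show ?thesis .
      qed
      have 1: "(\<Sum>l<m j. S Z s j l) = \<sigma> + T"
      proof -
        have "(\<Sum>l\<in>?K. S Z s j l) = T"
          unfolding T_def by (rule sum.cong) (use keep[OF Z s(1)] s' in auto)
        then show ?thesis using split[of "S Z s j"] by (simp add: self \<sigma>_def)
      qed
      have 2: "(\<Sum>l<m j. S Z s' j l) = - \<sigma> + \<rho> * T"
      proof -
        have "(\<Sum>l\<in>?K. S Z s' j l) = (\<Sum>l\<in>?K. \<rho> * S Y s j l)"
          by (rule sum.cong) (use keep[OF Z s'(1)] s s' SY in auto)
        then show ?thesis
          using split[of "S Z s' j"] self[of Z s' j] swap s'(4) by (simp add: T_def sum_distrib_left)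
      qed
      have 3: "(\<Sum>l<m i. S Z s i l) = (\<Sum>l<m i. S Y s i l)" if "i \<noteq> j" for i
        by (rule sum.cong) (use keep[OF Z s(1)] that in auto)
      have 4: "(\<Sum>l<m i. S Z s' i l) = \<rho> * (\<Sum>l<m i. S Y s i l)" if "i \<noteq> j" for i
        unfolding sum_distrib_left
        by (rule sum.cong) (use keep[OF Z s'(1)] that SY in auto)
      let ?others = "\<forall>i. i \<noteq> j \<longrightarrow> (\<Sum>l<m i. S Y s i l) = 0"
      have "s \<in> balanced m Z \<longleftrightarrow> ?others \<and> \<sigma> + T = 0"
        unfolding bal using s(1) 1 3 by metis
      moreover have "s' \<in> balanced m Z \<longleftrightarrow> ?others \<and> - \<sigma> + \<rho> * T = 0"
      proof -
        have "\<rho> \<noteq> 0" using \<rho> by auto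
        then show ?thesis unfolding bal using s'(1) 2 4 by (metis mult_eq_0_iff)
      qed
      ultimately show ?thesis using \<rho> \<sigma> by auto
    qed
    show ?thesis
    proof (rule odd_card_eq_if_agree_off_pair[of _ _ s s'])
      show "s \<noteq> s'" using s'(3) by auto
    qed (use off pair[OF X] pair[OF X'] in \<open>auto simp: finite_balanced\<close>)
  qed
qed

text \<open>
  Just before and just after each time \<open>t\<close> the configuration resolves the one at time \<open>t\<close>, so
  the parity is constant near \<open>t\<close> apart from \<open>t\<close> itself. The common nearby value \<open>h t\<close> is
  locally constant, hence constant on the line. At a time of general position the configuration
  resolves itself, and \<open>h t\<close> is the parity there.
\<close>
lemma odd_balanced_move:
  fixes X :: "'n::finite \<times> nat \<Rightarrow> real ^ 'n"
  assumes odd: "\<And>j. odd (m j)"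
    and gp: "general_position (labels m) X" "general_position (labels m) (X(z := q))"
    and unique: "\<And>t (p :: 'n \<Rightarrow> 'n \<times> nat) y p' y'.
       simplex_labels (labels m) p y \<Longrightarrow> orient (move X z q t \<circ> p) (move X z q t y) = 0 \<Longrightarrow>
       simplex_labels (labels m) p' y' \<Longrightarrow> orient (move X z q t \<circ> p') (move X z q t y') = 0 \<Longrightarrow>
       insert y (range p) = insert y' (range p')"
  shows "odd (card (balanced m X)) \<longleftrightarrow> odd (card (balanced m (X(z := q))))"
proof -
  let ?Z = "move X z q"
  define N where "N t = odd (card (balanced m (?Z t)))" for t
  define h where "h t = (\<forall>\<^sub>F u in at t. N u)" for t
  have near: "\<forall>\<^sub>F u in at t. resolves m (?Z u) (?Z t)" for t
  proof -
    define R where "R u s j k \<longleftrightarrow> orient (?Z u \<circ> graph s) (?Z u (j, k)) \<noteq> 0 \<and>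
       (orient (?Z t \<circ> graph s) (?Z t (j, k)) \<noteq> 0 \<longrightarrow>
        sgn (orient (?Z u \<circ> graph s) (?Z u (j, k))) = sgn (orient (?Z t \<circ> graph s) (?Z t (j, k))))"
      for u s j k
    have R: "\<forall>\<^sub>F u in at t. R u s j k" if slab: "simplex_labels (labels m) (graph s) (j, k)" for s j k
    proof -
      obtain a b where ab: "\<And>t. orient (?Z t \<circ> graph s) (?Z t (j, k)) = a + b * t"
        using orient_move_affine[OF slab] by metis
      have "a \<noteq> 0" using ab[of 0] general_positionD[OF gp(1) slab] by simp
      from eventually_affine_sgn[OF this, of b t] show ?thesis
        by (simp only: R_def ab)
    qed
    define Q where "Q = {(s, j, k). simplex_labels (labels m) (graph s) (j, k)}"
    have "Q \<subseteq> selections m \<times> labels m" by (auto simp: Q_def simplex_labels_graph)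
    then have "finite Q" using finite_selections[of m] finite_labels[of m] finite_subset by blast
    then have "\<forall>\<^sub>F u in at t. \<forall>x\<in>Q. R u (fst x) (fst (snd x)) (snd (snd x))"
      by (rule eventually_ball_finite) (auto simp: Q_def intro: R)
    then show ?thesis
      by eventually_elim (auto simp: resolves_def R_def Q_def)
  qed
  have "\<exists>b. \<forall>\<^sub>F u in at t. N u = b" for t
  proof -
    obtain v where v: "resolves m (?Z v) (?Z t)"
      using eventually_happens'[OF _ near[of t]] by auto
    have "\<forall>\<^sub>F u in at t. N u = N v"
      using near[of t]
    proof eventually_elim
      case (elim u)
      show ?case unfolding N_def
        by (rule odd_balanced_unchanged_by_crossing[OF odd elim v]) (rule unique[where t = t])
    qed
    then show ?thesis by blast
  qed
  then obtain b where b: "\<And>t. \<forall>\<^sub>F u in at t. N u = b t" by metis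
  have hb: "h t = b t" for t
  proof -
    have "h t \<longleftrightarrow> (\<forall>\<^sub>F u in at t. b t)"
      unfolding h_def by (rule eventually_cong[OF b]) simp
    then show ?thesis by (simp add: eventually_const_iff)
  qed
  have "h 0 = h 1"
  proof (rule connected_local_const[of UNIV 0 1 h])
    show "\<forall>t\<in>UNIV. \<forall>\<^sub>F u in at t. h t = h u"
    proof
      fix t :: real
      obtain U where U: "open U" "t \<in> U" "\<And>u. u \<in> U \<Longrightarrow> u \<noteq> t \<Longrightarrow> N u = b t"
        using b[of t] unfolding eventually_at_topological by auto
      have "h u = b t" if "u \<in> U" "u \<noteq> t" for u
      proof -
        have "open (U - {t})" using U(1) by (simp add: open_delete)
        then have "\<forall>\<^sub>F v in at u. N v = b t"
          unfolding eventually_at_topological using that U(3)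
          by (intro exI[of _ "U - {t}"]) auto
        with b[of u] have "\<forall>\<^sub>F v in at u. b u = b t" by eventually_elim simp
        then show ?thesis by (simp add: hb eventually_const_iff)
      qed
      then have "h t = h u" if "u \<in> U" for u
        using that hb[of t] by (cases "u = t") blast+
      then show "\<forall>\<^sub>F u in at t. h t = h u"
        unfolding eventually_at_topological using U(1,2) by blast
    qed
  qed auto
  moreover have "h t = N t" if gpt: "general_position (labels m) (?Z t)" for t
  proof -
    have self: "resolves m (?Z t) (?Z t)"
      using general_positionD[OF gpt] by (simp add: resolves_def)
    have "\<forall>\<^sub>F u in at t. N u = N t"
      using near[of t]
    proof eventually_elim
      case (elim u)
      show ?case unfolding N_def
        by (rule odd_balanced_unchanged_by_crossing[OF odd elim self]) (rule unique[where t = t])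
    qed
    with b[of t] have "\<forall>\<^sub>F u in at t. b t = N t" by eventually_elim simp
    then show ?thesis by (simp add: hb eventually_const_iff)
  qed
  ultimately have "N 0 = N 1" using gp by simp
  then show ?thesis by (simp add: N_def)
qed

text \<open>
  The points of \<open>X\<close> move one after the other to places close to their targets.
\<close>
lemma odd_balanced_approximation:
  fixes X Z :: "'n::finite \<times> nat \<Rightarrow> real ^ 'n"
  assumes odd: "\<And>j. odd (m j)"
    and X: "general_position (labels m) X" "odd (card (balanced m X))" and "\<epsilon> > 0"
  obtains X' where "general_position (labels m) X'" "odd (card (balanced m X'))"
    "\<And>y. y \<in> labels m \<Longrightarrow> dist (X' y) (Z y) < \<epsilon>"
proof -
  have "\<exists>X'. general_position (labels m) X' \<and> odd (card (balanced m X')) \<and>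
      (\<forall>y\<in>J. dist (X' y) (Z y) < \<epsilon>)" if "finite J" "J \<subseteq> labels m" for J
    using that
  proof (induction J rule: finite_induct)
    case empty
    then show ?case using X by auto
  next
    case (insert z J)
    then obtain X' where X': "general_position (labels m) X'" "odd (card (balanced m X'))"
      "\<forall>y\<in>J. dist (X' y) (Z y) < \<epsilon>" by auto
    from insert.prems have z: "z \<in> labels m" by simp
    from generic_move[OF finite_labels X'(1) z \<open>\<epsilon> > 0\<close>, of "Z z"]
    obtain q where q: "dist q (Z z) < \<epsilon>" "general_position (labels m) (X'(z := q))"
      and unique: "\<And>t (p :: 'n \<Rightarrow> 'n \<times> nat) y p' y'.
       simplex_labels (labels m) p y \<Longrightarrow> orient (move X' z q t \<circ> p) (move X' z q t y) = 0 \<Longrightarrow>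
       simplex_labels (labels m) p' y' \<Longrightarrow> orient (move X' z q t \<circ> p') (move X' z q t y') = 0 \<Longrightarrow>
       insert y (range p) = insert y' (range p')" by blast
    have "odd (card (balanced m (X'(z := q))))"
    proof (subst odd_balanced_move[OF odd X'(1) q(2), symmetric])
      show "odd (card (balanced m X'))" by fact
    qed (rule unique)
    moreover have "\<forall>y\<in>insert z J. dist ((X'(z := q)) y) (Z y) < \<epsilon>"
      using q(1) X'(3) by auto
    ultimately show ?case using q(2) by blast
  qed
  from this[OF finite_labels[of m] order_refl] show thesis using that by blast
qed

section \<open>A configuration with exactly one balanced choice\<close>

text \<open>
  The exponents \<open>1, \<dots>, n\<close> are assigned to the coordinates by \<open>e\<close>, as the index type
  carries no order.
\<close>
definition moment_curve :: "('n \<Rightarrow> nat) \<Rightarrow> real \<Rightarrow> real ^ 'n" where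
  "moment_curve e t = (\<chi> i. t ^ e i)"

text \<open>
  The height \<open>u \<bullet> moment_curve e t - c\<close> is a polynomial in \<open>t\<close> of degree at most \<open>n\<close>,
  and it has the \<open>n\<close> roots \<open>a i\<close>.
\<close>
lemma moment_curve_hyperplane_factorization:
  fixes a :: "'n::finite \<Rightarrow> real"
  assumes e: "bij_betw e (UNIV :: 'n set) {1..CARD('n)}" and "inj a"
    and u: "norm u = 1" "\<And>i. u \<bullet> moment_curve e (a i) = c"
  obtains C where "C \<noteq> 0" "\<And>t. u \<bullet> moment_curve e t - c = C * (\<Prod>i\<in>UNIV. t - a i)"
proof -
  let ?n = "CARD('n)"
  define Q where "Q = (\<Sum>i\<in>UNIV. Polynomial.monom (u $ i) (e i)) - [:c:]"
  have e_pos: "0 < e i" and e_le: "e i \<le> ?n" for i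
    using e by (auto simp: bij_betw_def dest!: equalityD1 subsetD[of "range e" _ "e i"])
  have Q: "poly Q t = u \<bullet> moment_curve e t - c" for t
    by (simp add: Q_def poly_sum poly_monom inner_vec_def moment_curve_def)
  define F where "F = (\<Prod>i\<in>UNIV. [:- a i, 1:])"
  have "degree F = (\<Sum>i\<in>(UNIV :: 'n set). 1)"
    unfolding F_def by (subst degree_prod_eq_sum_degree) auto
  then have degF: "degree F = ?n" by simp
  have "lead_coeff F = 1" unfolding F_def by (simp add: lead_coeff_prod)
  then have coeffF: "coeff F ?n = 1" using degF by simp
  have F: "poly F t = (\<Prod>i\<in>UNIV. t - a i)" for t
    by (simp add: F_def poly_prod)
  \<comment> \<open>Both polynomials have the same coefficient of degree \<open>n\<close>, so their difference has degree
    less than \<open>n\<close>, and it has \<open>n\<close> roots.\<close>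
  have "Q = smult (coeff Q ?n) F"
  proof (rule poly_eqI_degree_lead_coeff)
    show "coeff Q ?n = coeff (smult (coeff Q ?n) F) ?n" by (simp add: coeffF)
    show "?n \<le> card (range a)" using \<open>inj a\<close> by (simp add: card_image)
    show "degree Q \<le> ?n" unfolding Q_def
      by (intro degree_diff_le degree_sum_le) (auto intro: order_trans[OF degree_monom_le] e_le)
    show "degree (smult (coeff Q ?n) F) \<le> ?n" using degF by (metis degree_smult_le)
    show "poly Q z = poly (smult (coeff Q ?n) F) z" if "z \<in> range a" for z
      using that u(2) by (auto simp: Q F)
  qed
  then have fact: "u \<bullet> moment_curve e t - c = coeff Q ?n * (\<Prod>i\<in>UNIV. t - a i)" for t
    by (metis F Q poly_smult)
  have "coeff Q ?n \<noteq> 0"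
  proof
    assume "coeff Q ?n = 0"
    with \<open>Q = smult (coeff Q ?n) F\<close> have "Q = 0" by simp
    \<comment> \<open>The exponents \<open>e i\<close> are distinct and positive, so the constant \<open>c\<close> does not interfere.\<close>
    have "u $ i = 0" for i
    proof -
      have "coeff Q (e i) = (\<Sum>j\<in>UNIV. if j = i then u $ j else 0)"
        using e_pos[of i] inj_eq[OF bij_betw_imp_inj_on[OF e]]
        by (auto simp: Q_def coeff_sum coeff_pCons split: nat.splits intro!: sum.cong)
      then show ?thesis using \<open>Q = 0\<close> by simp
    qed
    then have "u = 0" by (simp add: vec_eq_iff)
    then show False using u(1) by simp
  qed
  then show thesis using that fact by blast
qed

text \<open>
  By the factorization, a hyperplane through \<open>n\<close> points of the curve contains no further point
  of it. Hence points of the curve are in general position and the orientation is a nonzero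
  multiple of the height.
\<close>
lemma orient_moment_curve:
  fixes a :: "'n::finite \<Rightarrow> real"
  assumes e: "bij_betw e (UNIV :: 'n set) {1..CARD('n)}" and "inj a"
  obtains C where "C \<noteq> 0"
    "\<And>t. orient (moment_curve e \<circ> a) (moment_curve e t) = C * (\<Prod>i\<in>UNIV. t - a i)"
proof -
  let ?g = "moment_curve e"
  obtain u c where u: "norm u = 1" "\<And>i. u \<bullet> (?g \<circ> a) i = c"
    using hyperplane_through_vertices[of "?g \<circ> a"] by blast
  obtain \<alpha> where \<alpha>: "\<And>x. orient (?g \<circ> a) x = \<alpha> * (u \<bullet> x - c)"
    using orient_eq_multiple[where p = "?g \<circ> a", OF u] by blast
  obtain C where C: "C \<noteq> 0" "\<And>t. u \<bullet> ?g t - c = C * (\<Prod>i\<in>UNIV. t - a i)"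
    using moment_curve_hyperplane_factorization[OF e \<open>inj a\<close> u(1), of c] u(2) by auto
  have "\<alpha> \<noteq> 0"
  proof
    assume "\<alpha> = 0"
    obtain t where t: "t \<notin> range a"
      using ex_new_if_finite[of "range a"] infinite_UNIV_char_0 by auto
    have "orient (?g \<circ> a) (?g t) = 0" using \<alpha> \<open>\<alpha> = 0\<close> by simp
    then obtain v where v: "norm v = 1" "\<And>i. v \<bullet> ?g (a i) = v \<bullet> ?g t"
      unfolding orient_eq_0_iff by auto
    obtain D where "D \<noteq> 0" "\<And>x. v \<bullet> ?g x - v \<bullet> ?g t = D * (\<Prod>i\<in>UNIV. x - a i)"
      using moment_curve_hyperplane_factorization[OF e \<open>inj a\<close> v] by blast
    from this(1) this(2)[of t] show False using t by auto
  qed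
  then show thesis using C \<alpha> by (intro that[of "\<alpha> * C"]) auto
qed

lemma sum_sgn_diff:
  assumes "a < m"
  shows "(\<Sum>k<m. sgn (real k - real a)) = real m - 1 - 2 * real a"
proof -
  have "(\<Sum>k<a + 1 + d. sgn (real k - real a)) = real d - real a" for d
  proof (induction d)
    case 0
    have "(\<Sum>k<a. sgn (real k - real a)) = (\<Sum>k<a. - 1)"
      by (rule sum.cong) (auto simp: sgn_if)
    then show ?case by simp
  next
    case (Suc d)
    have "(\<Sum>k<a + 1 + Suc d. sgn (real k - real a))
        = (\<Sum>k<a + 1 + d. sgn (real k - real a)) + sgn (real (a + 1 + d) - real a)"
      by simp
    also have "sgn (real (a + 1 + d) - real a) = 1" by (simp add: sgn_if)
    finally show ?case using Suc by simp
  qed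
  from this[of "m - a - 1"] show ?thesis using assms by (simp add: of_nat_diff)
qed

text \<open>
  The parameters \<open>e i * M + k\<close> with \<open>k < m i \<le> M\<close> place the colour classes in disjoint
  consecutive intervals of the moment curve. Within one colour class all factors \<open>t - a i\<close> of
  the other colours have a constant sign, so the points of that class before and after the
  chosen one lie on different sides. Balance thus means that every chosen point is the median of
  its class.
\<close>
lemma exists_configuration_with_odd_balanced:
  fixes m :: "'n::finite \<Rightarrow> nat"
  assumes odd: "\<And>j. odd (m j)"
  obtains X :: "'n \<times> nat \<Rightarrow> real ^ 'n"
  where "general_position (labels m) X" "odd (card (balanced m X))"
proof -
  obtain e where e: "bij_betw e (UNIV :: 'n set) {1..CARD('n)}"
    using finite_same_card_bij[of "UNIV :: 'n set" "{1..CARD('n)}"] by auto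
  define M where "M = Max (range m)"
  have M: "m i \<le> M" for i unfolding M_def by (rule Max_ge) auto
  define \<tau> where "\<tau> = (\<lambda>(i, k). real (e i * M + k))"
  have sep: "\<tau> (i, k) < \<tau> (i', k')" if "e i < e i'" "k < m i" for i k i' k'
  proof -
    have "e i * M + k < Suc (e i) * M" using that(2) M[of i] by simp
    also have "\<dots> \<le> e i' * M" using that(1) by (intro mult_le_mono1) simp
    finally show ?thesis by (simp add: \<tau>_def flip: of_nat_add of_nat_mult)
  qed
  have inj_e: "e i = e j \<longleftrightarrow> i = j" for i j
    using bij_betw_imp_inj_on[OF e] by (simp add: inj_eq)
  have inj_\<tau>: "inj_on \<tau> (labels m)"
  proof (rule inj_onI, clarify)
    fix i k i' k' assume "(i, k) \<in> labels m" "(i', k') \<in> labels m" and eq: "\<tau> (i, k) = \<tau> (i', k')"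
    then have "\<not> e i < e i'" "\<not> e i' < e i" using sep[of i i' k k'] sep[of i' i k' k] by auto
    then have "e i = e i'" by simp
    then show "i = i' \<and> k = k'" using eq inj_e by (auto simp: \<tau>_def)
  qed
  let ?X = "moment_curve e \<circ> \<tau>"
  have gp: "general_position (labels m) ?X"
    unfolding general_position_def
  proof (intro allI impI)
    fix p :: "'n \<Rightarrow> 'n \<times> nat" and y assume py: "simplex_labels (labels m) p y"
    then have "inj (\<tau> \<circ> p)"
      using inj_\<tau> by (auto simp: simplex_labels_def intro!: comp_inj_on intro: inj_on_subset)
    from orient_moment_curve[OF e this] obtain C where "C \<noteq> 0"
      "\<And>t. orient (moment_curve e \<circ> (\<tau> \<circ> p)) (moment_curve e t) = C * (\<Prod>i\<in>UNIV. t - (\<tau> \<circ> p) i)"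
      by blast
    moreover have "\<tau> y \<noteq> \<tau> (p i)" for i
      using inj_onD[OF inj_\<tau>, of y "p i"] py by (auto simp: simplex_labels_def)
    ultimately show "orient (?X \<circ> p) (?X y) \<noteq> 0" by (simp add: comp_assoc)
  qed
  have "s \<in> balanced m ?X \<longleftrightarrow> s = (\<lambda>j. m j div 2)" if s: "s \<in> selections m" for s
  proof -
    have sm: "s i < m i" for i using s by (simp add: selections_def)
    have "inj (\<tau> \<circ> graph s)"
      using inj_\<tau> sm by (auto intro!: comp_inj_on intro: inj_on_subset simp: graph_def labels_def)
    from orient_moment_curve[OF e this] obtain C where C: "C \<noteq> 0"
      "\<And>t. orient (moment_curve e \<circ> (\<tau> \<circ> graph s)) (moment_curve e t)
         = C * (\<Prod>i\<in>UNIV. t - (\<tau> \<circ> graph s) i)" by blast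
    have "(\<Sum>k<m j. sgn (orient (?X \<circ> graph s) (?X (j, k)))) = 0 \<longleftrightarrow> s j = m j div 2" for j
    proof -
      define E where "E = sgn C * (\<Prod>i\<in>UNIV - {j}. sgn (real (e j) - real (e i)))"
      have "E \<noteq> 0" using \<open>C \<noteq> 0\<close> inj_e by (auto simp: E_def sgn_zero_iff)
      have "sgn (orient (?X \<circ> graph s) (?X (j, k))) = E * sgn (real k - real (s j))"
        if k: "k < m j" for k
      proof -
        have "sgn (\<tau> (j, k) - \<tau> (i, s i)) = sgn (real (e j) - real (e i))" if "i \<noteq> j" for i
          using sep[of i j "s i" k] sep[of j i k "s i"] sm[of i] k inj_e[of i j] that
          by (cases "e i < e j") (auto simp: sgn_if)
        moreover have "\<tau> (j, k) - \<tau> (j, s j) = real k - real (s j)" by (simp add: \<tau>_def)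
        ultimately have "(\<Prod>i\<in>UNIV. sgn (\<tau> (j, k) - \<tau> (i, s i)))
            = sgn (real k - real (s j)) * (\<Prod>i\<in>UNIV - {j}. sgn (real (e j) - real (e i)))"
          by (subst prod.remove[of UNIV j]) (auto intro!: prod.cong)
        moreover have "sgn (\<Prod>i\<in>I. \<tau> (j, k) - \<tau> (i, s i)) = (\<Prod>i\<in>I. sgn (\<tau> (j, k) - \<tau> (i, s i)))" for I
         
          by (induction rule: infinite_finite_induct) (simp_all add: sgn_mult)
        ultimately show ?thesis
          using C(2)[of "\<tau> (j, k)"] by (simp add: comp_assoc sgn_mult E_def graph_def)
      qed
      then have "(\<Sum>k<m j. sgn (orient (?X \<circ> graph s) (?X (j, k))))
          = E * (\<Sum>k<m j. sgn (real k - real (s j)))"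
        by (simp add: sum_distrib_left)
      also have "\<dots> = E * (real (m j) - 1 - 2 * real (s j))"
        by (simp add: sum_sgn_diff[OF sm])
      also have "\<dots> = 0 \<longleftrightarrow> real (m j) = real (2 * s j + 1)"
        using \<open>E \<noteq> 0\<close> by auto
      also have "\<dots> \<longleftrightarrow> s j = m j div 2"
        unfolding of_nat_eq_iff using odd[of j] by presburger
      finally show ?thesis .
    qed
    then show ?thesis using s by (auto simp: balanced_def fun_eq_iff)
  qed
  moreover have "(\<lambda>j. m j div 2) \<in> selections m"
    using odd by (auto simp: selections_def intro!: div_less_dividend odd_pos)
  ultimately have "balanced m ?X = {\<lambda>j. m j div 2}"
    unfolding balanced_def by auto
  then show thesis using gp that[of ?X] by simp
qed

section \<open>The discrete ham sandwich theorem\<close>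

text \<open>
  The hyperplane may also be undetermined by the chosen points, namely \<open>\<alpha> = 0\<close>. In
  general position this happens only if there are no other points, and then every hyperplane
  through the chosen ones will do.
\<close>
lemma halving_hyperplane_of_balanced:
  fixes X :: "'n::finite \<times> nat \<Rightarrow> real ^ 'n"
  assumes gp: "general_position (labels m) X" and s: "s \<in> balanced m X"
  obtains u c where "norm u = 1" "\<And>j. u \<bullet> X (j, s j) = c"
    "\<And>j. 2 * card {k. k < m j \<and> u \<bullet> X (j, k) > c} < m j"
    "\<And>j. 2 * card {k. k < m j \<and> u \<bullet> X (j, k) < c} < m j"
proof -
  obtain u c where u: "norm u = 1" "\<And>i. u \<bullet> (X \<circ> graph s) i = c"
    using hyperplane_through_vertices by blast
  obtain \<alpha> where \<alpha>: "\<And>x. orient (X \<circ> graph s) x = \<alpha> * (u \<bullet> x - c)"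
    using orient_eq_multiple[where p = "X \<circ> graph s", OF u] by blast
  have sm: "s \<in> selections m" using s by (simp add: balanced_def)
  have us: "u \<bullet> X (j, s j) = c" for j using u(2)[of j] by (simp add: graph_def)
  have "2 * card {k. k < m j \<and> u \<bullet> X (j, k) > c} < m j \<and>
        2 * card {k. k < m j \<and> u \<bullet> X (j, k) < c} < m j" for j
  proof -
    define h where "h k = u \<bullet> X (j, k) - c" for k
    let ?P = "{k. k < m j \<and> u \<bullet> X (j, k) > c}" and ?N = "{k. k < m j \<and> u \<bullet> X (j, k) < c}"
    have "(\<Sum>k<m j. sgn (h k)) = 0"
    proof (cases "\<alpha> = 0")
      case True
      have "k = s j" if "k < m j" for k
        using gp sm that True \<alpha> simplex_labels_graph[of m s j k]
        by (auto simp: general_position_def)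
      then have "h k = 0" if "k < m j" for k using us that by (metis h_def diff_self)
      then show ?thesis by simp
    next
      case False
      have "(\<Sum>k<m j. sgn \<alpha> * sgn (h k)) = 0"
        using s by (simp add: balanced_def \<alpha> h_def sgn_mult)
      then show ?thesis using False by (simp add: sgn_zero_iff flip: sum_distrib_left)
    qed
    moreover have "(\<Sum>k<m j. sgn (h k)) = real (card ?P) - real (card ?N)"
    proof -
      have "(\<Sum>k<m j. sgn (h k)) = (\<Sum>k<m j. (if k \<in> ?P then 1 else 0) - (if k \<in> ?N then 1 else 0))"
        by (rule sum.cong) (auto simp: h_def sgn_if)
      also have "\<dots> = real (card ({..<m j} \<inter> ?P)) - real (card ({..<m j} \<inter> ?N))"
        by (simp only: sum_subtractf sum.If_cases finite_lessThan) simp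
      also have "{..<m j} \<inter> ?P = ?P" by auto
      also have "{..<m j} \<inter> ?N = ?N" by auto
      finally show ?thesis .
    qed
    ultimately have eq: "card ?P = card ?N" by simp
    have "?P \<union> ?N \<subseteq> {..<m j} - {s j}" using us by auto
    then have "card (?P \<union> ?N) \<le> card ({..<m j} - {s j})" by (intro card_mono) auto
    moreover have "card (?P \<union> ?N) = card ?P + card ?N" by (intro card_Un_disjoint) auto
    moreover have "s j < m j" using sm by (simp add: selections_def)
    ultimately show ?thesis using eq by simp
  qed
  then show thesis using that u(1) us by blast
qed

text \<open>
  Halving hyperplanes of approximating configurations have a convergent subsequence: their
  normals lie on the unit sphere, and their offsets are bounded because they contain a point of
  the configuration.
\<close>
lemma discrete_ham_sandwich_labelled:
  fixes Z :: "'n::finite \<times> nat \<Rightarrow> real ^ 'n"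
  assumes odd: "\<And>j. odd (m j)"
  obtains u c where "norm u = 1"
    "\<And>j. 2 * card {k. k < m j \<and> u \<bullet> Z (j, k) > c} < m j"
    "\<And>j. 2 * card {k. k < m j \<and> u \<bullet> Z (j, k) < c} < m j"
proof -
  obtain X0 :: "'n \<times> nat \<Rightarrow> real ^ 'n"
    where X0: "general_position (labels m) X0" "odd (card (balanced m X0))"
    using exists_configuration_with_odd_balanced[of m] odd by metis
  define good where "good N X u c s \<longleftrightarrow> s \<in> selections m \<and>
      (\<forall>y\<in>labels m. dist (X y) (Z y) < 1 / real (Suc N)) \<and> norm u = 1 \<and>
      (\<forall>j. u \<bullet> X (j, s j) = c) \<and> (\<forall>j. 2 * card {k. k < m j \<and> u \<bullet> X (j, k) > c} < m j) \<and>
      (\<forall>j. 2 * card {k. k < m j \<and> u \<bullet> X (j, k) < c} < m j)" for N X u c s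
  have "\<exists>X u c s. good N X u c s" for N
  proof -
    obtain X where X: "general_position (labels m) X" "odd (card (balanced m X))"
      "\<And>y. y \<in> labels m \<Longrightarrow> dist (X y) (Z y) < 1 / Suc N"
      using odd_balanced_approximation[OF odd X0, of "1 / Suc N" Z] by auto
    have "balanced m X \<noteq> {}" using X(2) by auto
    then obtain s where s: "s \<in> balanced m X" by blast
    then have sm: "s \<in> selections m" by (simp add: balanced_def)
    obtain u c where "norm u = 1" "\<And>j. u \<bullet> X (j, s j) = c"
      "\<And>j. 2 * card {k. k < m j \<and> u \<bullet> X (j, k) > c} < m j"
      "\<And>j. 2 * card {k. k < m j \<and> u \<bullet> X (j, k) < c} < m j"
      using halving_hyperplane_of_balanced[OF X(1) s] by blast
    then have "good N X u c s" using sm X(3) by (simp add: good_def)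
    then show ?thesis by blast
  qed
  then obtain X u c s where good: "\<And>N. good N (X N) (u N) (c N) (s N)" by metis
  have s: "s N \<in> selections m" and u: "norm (u N) = 1" for N
    using good[of N] by (simp_all add: good_def)
  have X: "dist (X N y) (Z y) < 1 / real (Suc N)" if "y \<in> labels m" for N y
    using good[of N] that by (simp add: good_def)
  have c: "u N \<bullet> X N (j, s N j) = c N"
    and pos: "2 * card {k. k < m j \<and> u N \<bullet> X N (j, k) > c N} < m j"
    and neg: "2 * card {k. k < m j \<and> u N \<bullet> X N (j, k) < c N} < m j" for N j
    using good[of N] by (simp_all add: good_def)
  define R where "R = 1 + (\<Sum>y\<in>labels m. norm (Z y))"
  have "\<bar>c N\<bar> \<le> R" for N
  proof -
    fix j :: 'n
    let ?y = "(j, s N j)"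
    have y: "?y \<in> labels m" using s[of N] by (simp add: selections_def labels_def)
    have "\<bar>c N\<bar> \<le> norm (X N ?y)"
      using Cauchy_Schwarz_ineq2[of "u N" "X N ?y"] c[of N j] u[of N] by simp
    also have "\<dots> \<le> norm (Z ?y) + dist (X N ?y) (Z ?y)"
      by (metis dist_norm norm_triangle_sub)
    also have "dist (X N ?y) (Z ?y) \<le> 1"
      using X[OF y, of N] by (rule order.strict_implies_order[OF order.strict_trans2]) simp
    also have "norm (Z ?y) \<le> (\<Sum>y\<in>labels m. norm (Z y))"
      using y finite_labels by (intro member_le_sum) auto
    finally show ?thesis by (simp add: R_def)
  qed
  then have mem: "\<forall>N. (u N, c N) \<in> sphere 0 1 \<times> cball 0 R" using u by simp
  have "seq_compact (sphere (0 :: real ^ 'n) 1 \<times> cball (0 :: real) R)"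
    by (intro compact_imp_seq_compact compact_Times) auto
  from seq_compactE[OF this mem] obtain l r where l: "l \<in> sphere (0 :: real ^ 'n) 1 \<times> cball (0 :: real) R"
    and r: "strict_mono (r :: nat \<Rightarrow> nat)" and lim': "((\<lambda>N. (u N, c N)) \<circ> r) \<longlonglongrightarrow> l"
    by metis
  from lim' have lim: "(\<lambda>N. (u (r N), c (r N))) \<longlonglongrightarrow> l" by (simp add: o_def)
  define U C where "U = fst l" and "C = snd l"
  have U: "(\<lambda>N. u (r N)) \<longlonglongrightarrow> U" and C: "(\<lambda>N. c (r N)) \<longlonglongrightarrow> C"
    using tendsto_fst[OF lim] tendsto_snd[OF lim] by (simp_all add: U_def C_def)
  have XZ: "(\<lambda>N. X (r N) y) \<longlonglongrightarrow> Z y" if "y \<in> labels m" for y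
  proof -
    have "(\<lambda>N. X N y) \<longlonglongrightarrow> Z y"
      using X[OF that] LIMSEQ_norm_0[of "\<lambda>N. X N y - Z y"]
      by (simp add: dist_norm LIM_zero_iff)
    then show ?thesis using LIMSEQ_subseq_LIMSEQ[OF _ r] by (simp add: o_def)
  qed
  have lim_height: "(\<lambda>N. u (r N) \<bullet> X (r N) (j, k) - c (r N)) \<longlonglongrightarrow> U \<bullet> Z (j, k) - C"
    if "k < m j" for j k
    using that by (intro tendsto_intros U C XZ) (simp add: labels_def)
  have "\<exists>N. card {k. k < m j \<and> 0 < \<sigma> * (U \<bullet> Z (j, k) - C)}
      \<le> card {k. k < m j \<and> 0 < \<sigma> * (u (r N) \<bullet> X (r N) (j, k) - c (r N))}" for \<sigma> :: real and j
  proof -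
    let ?K = "{k. k < m j \<and> 0 < \<sigma> * (U \<bullet> Z (j, k) - C)}"
    have "\<forall>\<^sub>F N in sequentially. \<forall>k\<in>?K. 0 < \<sigma> * (u (r N) \<bullet> X (r N) (j, k) - c (r N))"
    proof (rule eventually_ball_finite)
      show "\<forall>k\<in>?K. \<forall>\<^sub>F N in sequentially. 0 < \<sigma> * (u (r N) \<bullet> X (r N) (j, k) - c (r N))"
      proof
        fix k assume "k \<in> ?K"
        then have "k < m j" and pos: "0 < \<sigma> * (U \<bullet> Z (j, k) - C)" by auto
        from lim_height[OF this(1)] have "(\<lambda>N. \<sigma> * (u (r N) \<bullet> X (r N) (j, k) - c (r N)))
            \<longlonglongrightarrow> \<sigma> * (U \<bullet> Z (j, k) - C)" by (rule tendsto_mult_left)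
        from order_tendstoD(1)[OF this pos]
        show "\<forall>\<^sub>F N in sequentially. 0 < \<sigma> * (u (r N) \<bullet> X (r N) (j, k) - c (r N))" .
      qed
    qed simp
    then obtain N where "\<forall>k\<in>?K. 0 < \<sigma> * (u (r N) \<bullet> X (r N) (j, k) - c (r N))"
      using eventually_happens'[OF sequentially_bot] by blast
    then show ?thesis by (intro exI[of _ N] card_mono) auto
  qed
  from this[of _ 1] this[of _ "-1"] have
    "\<exists>N. card {k. k < m j \<and> U \<bullet> Z (j, k) > C} \<le> card {k. k < m j \<and> u (r N) \<bullet> X (r N) (j, k) > c (r N)}"
    "\<exists>N. card {k. k < m j \<and> U \<bullet> Z (j, k) < C} \<le> card {k. k < m j \<and> u (r N) \<bullet> X (r N) (j, k) < c (r N)}"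
    for j by simp_all
  then have "2 * card {k. k < m j \<and> U \<bullet> Z (j, k) > C} < m j"
    "2 * card {k. k < m j \<and> U \<bullet> Z (j, k) < C} < m j" for j
    using pos[of j] neg[of j] by (meson le_less_trans mult_le_mono2)+
  moreover have "norm U = 1" using l by (auto simp: U_def)
  ultimately show thesis using that by blast
qed

lemma discrete_ham_sandwich_odd:
  fixes B :: "'n::finite \<Rightarrow> (real ^ 'n) set"
  assumes fin: "\<And>j. finite (B j)" and odd: "\<And>j. odd (card (B j))"
  obtains u c where "norm u = 1"
    "\<And>j. 2 * card (B j \<inter> pos_halfspace u c) < card (B j)"
    "\<And>j. 2 * card (B j \<inter> neg_halfspace u c) < card (B j)"
proof -
  have "\<exists>f. bij_betw f {..<card (B j)} (B j)" for j
    using ex_bij_betw_nat_finite[OF fin[of j]] by (simp add: atLeast0LessThan)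
  then obtain f where f: "\<And>j. bij_betw (f j) {..<card (B j)} (B j)" by metis
  define Z where "Z = (\<lambda>(j, k). f j k)"
  obtain u c where uc: "norm u = 1"
    "\<And>j. 2 * card {k. k < card (B j) \<and> u \<bullet> Z (j, k) > c} < card (B j)"
    "\<And>j. 2 * card {k. k < card (B j) \<and> u \<bullet> Z (j, k) < c} < card (B j)"
    using discrete_ham_sandwich_labelled[of "\<lambda>j. card (B j)" Z] odd by blast
  have "card {k. k < card (B j) \<and> P (Z (j, k))} = card (B j \<inter> Collect P)" for j P
  proof -
    have "f j ` {k. k < card (B j) \<and> P (Z (j, k))} = B j \<inter> Collect P"
      using bij_betw_imp_surj_on[OF f[of j]] by (auto simp: Z_def)
    moreover have "inj_on (f j) {k. k < card (B j) \<and> P (Z (j, k))}"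
      using bij_betw_imp_inj_on[OF f[of j]] by (rule inj_on_subset) auto
    ultimately show ?thesis by (metis card_image)
  qed
  from this[of _ "\<lambda>x. u \<bullet> x > c"] this[of _ "\<lambda>x. u \<bullet> x < c"] show thesis
    using that[of u c] uc by (simp add: pos_halfspace_def neg_halfspace_def)
qed

text \<open>
  For even \<open>card A\<close> the subset has \<open>card A - 1\<close> points, and less than half of them means at most
  \<open>card A / 2 - 1\<close>, which leaves room for the deleted point on either side. In both cases the
  two open sides together do not exhaust \<open>B\<close>.
\<close>
lemma odd_subset_with_sufficient_halving:
  fixes A :: "(real ^ 'n) set"
  assumes "finite A" "A \<noteq> {}"
  obtains B where "finite B" "odd (card B)"
    "\<And>u c. 2 * card (B \<inter> pos_halfspace u c) < card B \<Longrightarrow>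
       2 * card (B \<inter> neg_halfspace u c) < card B \<Longrightarrow>
       bisects u c A \<and> hyperplane u c \<inter> A \<noteq> {}"
proof -
  obtain a where "a \<in> A" using \<open>A \<noteq> {}\<close> by blast
  define B where "B = (if odd (card A) then A else A - {a})"
  have "B \<subseteq> A" and finB: "finite B" using \<open>finite A\<close> by (auto simp: B_def)
  have card_A: "card A = Suc (card B)" if "even (card A)"
    unfolding B_def using that \<open>a \<in> A\<close> \<open>finite A\<close> by (simp del: card_Diff_insert add: card_Suc_Diff1)
  then have odd: "odd (card B)" by (cases "odd (card A)") (simp_all add: B_def)
  have half: "2 * card (A \<inter> S) \<le> card A" if S: "2 * card (B \<inter> S) < card B" for S
  proof (cases "odd (card A)")
    case True
    then show ?thesis using S by (simp add: B_def)
  next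
    case False
    have "A \<inter> S \<subseteq> insert a (B \<inter> S)" by (auto simp: B_def)
    then have "card (A \<inter> S) \<le> card (insert a (B \<inter> S))"
      using finB by (intro card_mono) auto
    also have "\<dots> \<le> Suc (card (B \<inter> S))" using finB by (simp add: card_insert_if)
    finally show ?thesis using S card_A False by simp
  qed
  have "bisects u c A \<and> hyperplane u c \<inter> A \<noteq> {}"
    if pos: "2 * card (B \<inter> pos_halfspace u c) < card B"
      and neg: "2 * card (B \<inter> neg_halfspace u c) < card B" for u c
  proof
    let ?P = "pos_halfspace u c" and ?N = "neg_halfspace u c"
    show "bisects u c A" using half[OF pos] half[OF neg] by (simp add: bisects_def)
    have "card ((B \<inter> ?P) \<union> (B \<inter> ?N)) \<le> card (B \<inter> ?P) + card (B \<inter> ?N)" by (rule card_Un_le)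
    then have "(B \<inter> ?P) \<union> (B \<inter> ?N) \<noteq> B" using pos neg by auto
    then obtain x where "x \<in> B" "x \<notin> ?P" "x \<notin> ?N" by blast
    then have "x \<in> hyperplane u c \<inter> A"
      using \<open>B \<subseteq> A\<close> by (auto simp: hyperplane_def pos_halfspace_def neg_halfspace_def)
    then show "hyperplane u c \<inter> A \<noteq> {}" by blast
  qed
  with finB odd show thesis by (rule that)
qed

lemma hyperplane_minus:
  "hyperplane (- u) (- c) = hyperplane u c" "bisects (- u) (- c) A \<longleftrightarrow> bisects u c A"
proof -
  have "pos_halfspace (- u) (- c) = neg_halfspace u c" "neg_halfspace (- u) (- c) = pos_halfspace u c"
    by (simp_all add: pos_halfspace_def neg_halfspace_def)
  then show "bisects (- u) (- c) A \<longleftrightarrow> bisects u c A" by (auto simp: bisects_def)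
qed (simp add: hyperplane_def)

theorem corollary3:
  fixes A :: "nat \<Rightarrow> (real ^ 'n) set"
  assumes "\<And>i. i \<in> {1..CARD('n)} \<Longrightarrow> finite (A i)"
    and "\<And>i. i \<in> {1..CARD('n)} \<Longrightarrow> A i \<noteq> {}"
  shows "\<exists>u c. hyperplane_params u c \<and>
           (\<forall>i\<in>{1..CARD('n)}. bisects u c (A i) \<and> hyperplane u c \<inter> A i \<noteq> {})"
proof -
  obtain e where e: "bij_betw e (UNIV :: 'n set) {1..CARD('n)}"
    using finite_same_card_bij[of "UNIV :: 'n set" "{1..CARD('n)}"] by auto
  then have e_in: "e j \<in> {1..CARD('n)}" for j by (auto simp: bij_betw_def)
  have "\<exists>B. finite B \<and> odd (card B) \<and> (\<forall>u c. 2 * card (B \<inter> pos_halfspace u c) < card B \<longrightarrow>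
      2 * card (B \<inter> neg_halfspace u c) < card B \<longrightarrow>
      bisects u c (A (e j)) \<and> hyperplane u c \<inter> A (e j) \<noteq> {})" for j
    by (rule odd_subset_with_sufficient_halving[OF assms[OF e_in]]) blast
  then obtain B where B: "\<And>j. finite (B j)" "\<And>j. odd (card (B j))"
    and sufficient: "\<And>j u c. 2 * card (B j \<inter> pos_halfspace u c) < card (B j) \<Longrightarrow>
      2 * card (B j \<inter> neg_halfspace u c) < card (B j) \<Longrightarrow>
      bisects u c (A (e j)) \<and> hyperplane u c \<inter> A (e j) \<noteq> {}"
    by metis
  obtain u c where uc: "norm u = 1"
    "\<And>j. 2 * card (B j \<inter> pos_halfspace u c) < card (B j)"
    "\<And>j. 2 * card (B j \<inter> neg_halfspace u c) < card (B j)"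
    using discrete_ham_sandwich_odd[of B, OF B] by blast
  have cut: "bisects u c (A i) \<and> hyperplane u c \<inter> A i \<noteq> {}" if i: "i \<in> {1..CARD('n)}" for i
  proof -
    have "i \<in> range e" using e i unfolding bij_betw_def by blast
    then obtain j where j: "i = e j" by blast
    show ?thesis unfolding j using uc(2,3) by (rule sufficient)
  qed
  \<comment> \<open>The offset must be nonnegative; changing the signs of both parameters swaps the half-spaces.\<close>
  show ?thesis
  proof (cases "c \<ge> 0")
    case True
    then have "hyperplane_params u c" using uc(1) by (simp add: hyperplane_params_def)
    then show ?thesis using cut by blast
  next
    case False
    then have "hyperplane_params (- u) (- c)" using uc(1) by (simp add: hyperplane_params_def)
    then show ?thesis using cut hyperplane_minus[of u c] by metis
  qed
qed

end
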